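(* Let $X$ and $Z$ be Hausdorff topological vector spaces, let $C\subseteq Z$ be a convex and pointed cone with nonempty interior and let $K$ be a nonempty convex subset of $X$. Consider mappings $f,g:K\times K\to Z$. Let $x_0\in K$ be such that $g(x_0,y)\notin-\operatorname{int}C$ for all $y\in K$. Assume that the following statements hold. (i) For all $y\in K$ with $y\neq x_0$ and all $t\in\,]0,1[$ one has $g(x_0,(1-t)x_0+ty)-f((1-t)x_0+ty,y)-g(x_0,y)\in-\operatorname{int}C$. (ii) For every $y\in K$ the following implication holds: if $f((1-t)x_0+ty,y)+g(x_0,y)\notin-\operatorname{int}C$ for all $t\in\,]0,1]$, then $f(x_0,y)+g(x_0,y)\notin-\operatorname{int}C$. (iii) For all $x\in K$, $f(x,x)=0$. Then $f(x_0,y)+g(x_0,y)\notin-\operatorname{int}C$ for all $y\in K$.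
   Context: All spaces are real. A cone $C$ satisfies $tc\in C$ for all $c\in C$, $t\ge 0$; it is convex if $C+C=C$ and pointed if $C\cap(-C)=\{0\}$ ($C$ is not assumed closed). $\operatorname{int}C$ is the interior of $C$. *)

theory Defs
  imports "HOL-Analysis.Analysis" "HOL-Library.Set_Algebras"
begin

(* Real topological vector spaces (not necessarily Hausdorff): the vector operations
   are jointly continuous. Nothing like a norm, a metric or local convexity is assumed. *)
class real_topological_vector = real_vector + topological_ab_group_add +
  assumes tendsto_scaleR_nhds:
    "((\<lambda>p. fst p *\<^sub>R snd p) \<longlongrightarrow> r *\<^sub>R a) (nhds r \<times>\<^sub>F nhds a)"

class hausdorff_real_topological_vector = real_topological_vector + t2_space

instance real_normed_vector \<subseteq> hausdorff_real_topological_vector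
proof
  fix r :: real and a :: 'a
  show "((\<lambda>p. fst p *\<^sub>R snd p) \<longlongrightarrow> r *\<^sub>R a) (nhds r \<times>\<^sub>F nhds a)"
    by (intro tendsto_scaleR filterlim_fst filterlim_snd)
qed

(* In the sense of the source, a cone is convex if C + C = C (Minkowski sum).
   The symbol - applied to a set denotes its complement, so the reflected set
   is written uminus ` C. *)
definition convex_pointed_cone :: "'a::real_vector set \<Rightarrow> bool"
  where "convex_pointed_cone C \<longleftrightarrow> cone C \<and> C + C = C \<and> C \<inter> uminus ` C = {0}"

end

theory Submission
  imports Defs
begin

text \<open>
  Everything rests on \<open>interior C\<close> being closed under addition, which carries over to
  \<open>- interior C\<close> (\<open>uminus_interior_add_closed\<close>). Suppose that
  \<open>f z y + g x0 y\<close> lay in \<open>- interior C\<close> for some \<open>z\<close> strictly between \<open>x0\<close> and \<open>y\<close>. Adding it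
  to the element \<open>g x0 z - f z y - g x0 y\<close> of \<open>- interior C\<close> provided by (i), everything cancels
  but \<open>g x0 z\<close>, which would then lie in \<open>- interior C\<close>, against the choice of \<open>x0\<close>. At the
  endpoint \<open>z = y\<close> the term \<open>f y y\<close> vanishes and only \<open>g x0 y\<close> is left. So the premise of (ii)
  holds for every \<open>y \<noteq> x0\<close>. For \<open>y = x0\<close> the term \<open>f x0 x0\<close> vanishes, and the claim is the
  choice of \<open>x0\<close> again.
\<close>

lemma open_translation_group:
  fixes S :: "'a::topological_ab_group_add set"
  assumes "open S"
  shows "open ((+) a ` S)"
proof -
  have "(+) a ` S = (\<lambda>x. x - a) -` S"
    by (force simp: image_iff algebra_simps)
  moreover have "open ((\<lambda>x. x - a) -` S)"
    by (intro open_vimage assms continuous_intros)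
  ultimately show ?thesis by simp
qed

text \<open>
  Translating the open set \<open>interior C\<close> by an element of \<open>C\<close> gives an open set, which additivity
  keeps inside \<open>C\<close>; hence it lies in the interior.
\<close>

lemma interior_add_closed:
  fixes C :: "'a::topological_ab_group_add set"
  assumes "C + C \<subseteq> C" and "a \<in> interior C" and "b \<in> interior C"
  shows "a + b \<in> interior C"
proof (rule interiorI)
  show "open ((+) a ` interior C)"
    by (intro open_translation_group open_interior)
  show "a + b \<in> (+) a ` interior C"
    using assms(3) by blast
  show "(+) a ` interior C \<subseteq> C"
    using assms(1,2) interior_subset[of C] by (fastforce simp: set_plus_def)
qed

lemma uminus_interior_add_closed:
  fixes C :: "'a::topological_ab_group_add set"
  assumes "C + C \<subseteq> C" and "a \<in> uminus ` interior C" and "b \<in> uminus ` interior C"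
  shows "a + b \<in> uminus ` interior C"
proof -
  obtain u v where uv: "u \<in> interior C" "v \<in> interior C" and "a = - u" "b = - v"
    using assms(2,3) by blast
  then have "a + b = - (u + v)"
    by simp
  then show ?thesis
    using interior_add_closed[OF assms(1) uv] by blast
qed

theorem theorem5p4:
  fixes C :: "'z::hausdorff_real_topological_vector set"
    and K :: "'x::hausdorff_real_topological_vector set"
    and f g :: "'x \<Rightarrow> 'x \<Rightarrow> 'z"
    and x0 :: 'x
  assumes "convex_pointed_cone C"
    and "interior C \<noteq> {}"
    and "K \<noteq> {}"
    and "convex K"
    and "x0 \<in> K"
    and "\<forall>y\<in>K. g x0 y \<notin> uminus ` interior C"
    and "\<forall>y\<in>K. y \<noteq> x0 \<longrightarrow> (\<forall>t\<in>{0<..<1::real}.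
           g x0 ((1 - t) *\<^sub>R x0 + t *\<^sub>R y) - f ((1 - t) *\<^sub>R x0 + t *\<^sub>R y) y - g x0 y
             \<in> uminus ` interior C)"
    and "\<forall>y\<in>K. (\<forall>t\<in>{0<..1::real}.
             f ((1 - t) *\<^sub>R x0 + t *\<^sub>R y) y + g x0 y \<notin> uminus ` interior C)
           \<longrightarrow> f x0 y + g x0 y \<notin> uminus ` interior C"
    and "\<forall>x\<in>K. f x x = 0"
  shows "\<forall>y\<in>K. f x0 y + g x0 y \<notin> uminus ` interior C"
proof
  fix y assume y: "y \<in> K"
  have CC: "C + C \<subseteq> C"
    using assms(1) by (simp add: convex_pointed_cone_def)
  show "f x0 y + g x0 y \<notin> uminus ` interior C"
  proof (cases "y = x0")
    case True
    then show ?thesis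
      using assms(5,6,9) by simp
  next
    case False
    have "f ((1 - t) *\<^sub>R x0 + t *\<^sub>R y) y + g x0 y \<notin> uminus ` interior C"
      if t: "t \<in> {0<..1}" for t :: real
    proof (cases "t = 1")
      case True
      then show ?thesis
        using assms(6,9) y by simp
    next
      case t_ne: False
      define z where "z = (1 - t) *\<^sub>R x0 + t *\<^sub>R y"
      have "z \<in> K"
        unfolding z_def using t by (intro convexD assms(4,5) y) auto
      have step: "g x0 z - f z y - g x0 y \<in> uminus ` interior C"
        unfolding z_def using assms(7) y False t t_ne by force
      have "f z y + g x0 y \<notin> uminus ` interior C"
      proof
        assume "f z y + g x0 y \<in> uminus ` interior C"
        from uminus_interior_add_closed[OF CC step this]
        have "g x0 z \<in> uminus ` interior C"
          by (simp add: algebra_simps)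
        with assms(6) \<open>z \<in> K\<close> show False
          by blast
      qed
      then show ?thesis
        unfolding z_def .
    qed
    then show ?thesis
      using assms(8) y by blast
  qed
qed

end
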